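(* Suppose $\frac1n\le a<b\le\frac{n-1}{n}$. Then the random dictator rule $f(\nu)=\nu$ is the unique approximation-ratio-maximizing aggregation rule (i.e. the unique maximizer of $\mathrm{Appr}(f)$ over all aggregation rules $f$). Moreover, $\mathrm{Appr}=(1-\mu)(1-a)+\mu b$.
   Context: Setting: fix a number of agents $n\ge 1$, a prior $\mu\in(0,1)$ and posteriors $0\le p_1<\frac12<p_2\le 1$ with $p_1<\mu<p_2$. An information structure is a probability distribution $\pi$ on $\{0,1\}\times\{L,H\}^n$, the law of $(\omega,s_1,\dots,s_n)$ (state and binary signals of the $n$ agents), such that $\pi(\omega=1)=\mu$ and, for every $i$, both values of $s_i$ have positive probability and $\pi(\omega=1\mid s_i=L)=p_1$, $\pi(\omega=1\mid s_i=H)=p_2$. Define $$a=\frac{(1-p_2)(\mu-p_1)}{(1-\mu)(p_2-p_1)},\qquad b=\frac{p_2(\mu-p_1)}{\mu(p_2-p_1)},$$ which are the probabilities that a given agent gets signal $H$ conditional on $\omega=0$ and $\omega=1$, respectively. Let $\nu\in\{0,\frac1n,\dots,1\}$ be the fraction of agents $i$ with $s_i=H$; $\hat\pi$ is the law of $(\omega,\nu)$ induced by $\pi$, and $\hat\pi_0,\hat\pi_1$ are the conditional laws of $\nu$ given $\omega=0$ and $\omega=1$. An aggregation rule is a function $f:\{0,\frac1n,\dots,1\}\to[0,1]$ ($f(\nu)$ is the probability that the decision maker guesses $\omega=1$ after observing $\nu$). The probability of a correct guess is $P(f,\pi)=\mu\,\mathbb{E}_{\nu\sim\hat\pi_1}[f(\nu)]+(1-\mu)\,\mathbb{E}_{\nu\sim\hat\pi_0}[1-f(\nu)]$;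 that of a Bayesian decision maker who knows $\pi$ is $P^*(\pi)=\mathbb{E}_{\nu\sim\hat\pi}[\max\{\hat\pi(\omega=0\mid\nu),\hat\pi(\omega=1\mid\nu)\}]$. Approximation ratio: $\mathrm{Appr}(f,\pi)=\frac{P(f,\pi)}{P^*(\pi)}$, $\mathrm{Appr}(f)=\min_\pi\mathrm{Appr}(f,\pi)$ over all information structures $\pi$ (with the given $n,\mu,p_1,p_2$), and $\mathrm{Appr}=\max_f\mathrm{Appr}(f)$ over all aggregation rules. The random dictator rule is $f(\frac kn)=\frac kn$ for $0\le k\le n$. *)

theory Defs
  imports "HOL-Probability.Probability"
begin

datatype signal = Lo | Hi

text \<open>
  An outcome is a pair of a state, with \<open>True\<close> for \<open>\<omega> = 1\<close> and \<open>False\<close> for \<open>\<omega> = 0\<close>, and a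
  signal profile, whose \<open>i\<close>-th entry is the signal of agent \<open>i\<close> (agents are \<open>0, \<dots>, n - 1\<close>).
\<close>

type_synonym outcome = "bool \<times> signal list"

definition info_structures :: "nat \<Rightarrow> real \<Rightarrow> real \<Rightarrow> real \<Rightarrow> outcome pmf set" where
  "info_structures n mu p1 p2 = {\<pi>.
     (\<forall>(w, s) \<in> set_pmf \<pi>. length s = n) \<and>
     \<P>((w, s) in measure_pmf \<pi>. w) = mu \<and>
     (\<forall>i<n.
        \<P>((w, s) in measure_pmf \<pi>. s ! i = Lo) > 0 \<and>
        \<P>((w, s) in measure_pmf \<pi>. s ! i = Hi) > 0 \<and>
        \<P>(x in measure_pmf \<pi>. fst x \<bar> snd x ! i = Lo) = p1 \<and>
        \<P>(x in measure_pmf \<pi>. fst x \<bar> snd x ! i = Hi) = p2)}"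

text \<open>
  Bayes plausibility forces every information structure to give each agent the signal \<open>Hi\<close>
  with exactly these probabilities, conditional on \<open>\<omega> = 0\<close> and \<open>\<omega> = 1\<close>.
\<close>

definition prob_Hi_given_0 :: "real \<Rightarrow> real \<Rightarrow> real \<Rightarrow> real" where
  "prob_Hi_given_0 mu p1 p2 = (1 - p2) * (mu - p1) / ((1 - mu) * (p2 - p1))"

definition prob_Hi_given_1 :: "real \<Rightarrow> real \<Rightarrow> real \<Rightarrow> real" where
  "prob_Hi_given_1 mu p1 p2 = p2 * (mu - p1) / (mu * (p2 - p1))"

definition fractions :: "nat \<Rightarrow> real set" where
  "fractions n = (\<lambda>k. real k / real n) ` {0..n}"

definition hi_fraction :: "signal list \<Rightarrow> real" where
  "hi_fraction s = real (card {i. i < length s \<and> s ! i = Hi}) / real (length s)"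

definition hat :: "outcome pmf \<Rightarrow> (bool \<times> real) pmf" where
  "hat \<pi> = map_pmf (\<lambda>(w, s). (w, hi_fraction s)) \<pi>"

definition hat_cond :: "bool \<Rightarrow> outcome pmf \<Rightarrow> real pmf" where
  "hat_cond w \<pi> = map_pmf snd (cond_pmf (hat \<pi>) {x. fst x = w})"

text \<open>
  Aggregation rules are taken to be undefined outside their domain (extensional functions),
  so that equality of rules is equality of functions on \<open>{0, 1/n, \<dots>, 1}\<close>.
\<close>

definition aggregation_rules :: "nat \<Rightarrow> (real \<Rightarrow> real) set" where
  "aggregation_rules n = (fractions n \<rightarrow>\<^sub>E {0..1})"

definition random_dictator :: "nat \<Rightarrow> real \<Rightarrow> real" where
  "random_dictator n = restrict (\<lambda>\<nu>. \<nu>) (fractions n)"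

definition prob_correct :: "real \<Rightarrow> (real \<Rightarrow> real) \<Rightarrow> outcome pmf \<Rightarrow> real" where
  "prob_correct mu f \<pi> =
     mu * measure_pmf.expectation (hat_cond True \<pi>) f +
     (1 - mu) * measure_pmf.expectation (hat_cond False \<pi>) (\<lambda>\<nu>. 1 - f \<nu>)"

definition bayes_prob_correct :: "outcome pmf \<Rightarrow> real" where
  "bayes_prob_correct \<pi> =
     measure_pmf.expectation (map_pmf snd (hat \<pi>))
       (\<lambda>\<nu>. max \<P>(x in measure_pmf (hat \<pi>). fst x = False \<bar> snd x = \<nu>)
                 \<P>(x in measure_pmf (hat \<pi>). fst x = True \<bar> snd x = \<nu>))"

definition appr_ratio :: "real \<Rightarrow> (real \<Rightarrow> real) \<Rightarrow> outcome pmf \<Rightarrow> real" where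
  "appr_ratio mu f \<pi> = prob_correct mu f \<pi> / bayes_prob_correct \<pi>"

text \<open>
  The minimum over information structures and the maximum over aggregation rules are genuine
  extrema (\<open>LEAST\<close>, \<open>GREATEST\<close>) rather than \<open>Inf\<close> and \<open>Sup\<close>: nothing can be proved about
  their values without showing that they are attained.
\<close>

definition rule_appr :: "nat \<Rightarrow> real \<Rightarrow> real \<Rightarrow> real \<Rightarrow> (real \<Rightarrow> real) \<Rightarrow> real" where
  "rule_appr n mu p1 p2 f = (LEAST r. r \<in> appr_ratio mu f ` info_structures n mu p1 p2)"

definition best_appr :: "nat \<Rightarrow> real \<Rightarrow> real \<Rightarrow> real \<Rightarrow> real" where
  "best_appr n mu p1 p2 = (GREATEST r. r \<in> rule_appr n mu p1 p2 ` aggregation_rules n)"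

end

theory Submission
  imports Defs
begin

text \<open>
  Only the laws \<open>x\<close> and \<open>y\<close> of the number of \<open>Hi\<close> signals given \<open>\<omega> = 0\<close> and \<open>\<omega> = 1\<close> matter, and
  the realisable pairs are exactly those with means \<open>n a\<close> and \<open>n b\<close>. These sets are compact, so the
  minimum over information structures is attained. The random dictator is correct with
  probability \<open>R = (1 - mu) (1 - a) + mu b\<close> for every pair, and the Bayesian is always correct
  when \<open>x\<close> and \<open>y\<close> have disjoint supports, for instance \<open>{0, n}\<close> and \<open>{1, n - 1}\<close>.

  If a rule \<open>f\<close> does at least as well, then \<open>g k = f (k / n) - k / n\<close> satisfies \<open>(1 - mu) E\<^sub>x g \<le> mu E\<^sub>y g\<close>
  for all disjoint two-point laws. Subtract from \<open>g\<close> its chord through \<open>0\<close> and \<open>n\<close>. The four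
  tests that distribute \<open>0, 1, n - 1, n\<close> over \<open>x\<close> and \<open>y\<close> weigh the remainder at \<open>1\<close> and \<open>n - 1\<close> with
  all four combinations of signs, so one of them shows that the chord alone passes the test.
  As \<open>g 0 \<ge> 0 \<ge> g n\<close> and the signals are informative (\<open>p1 < 1/2 < p2\<close>), this forces
  \<open>g 0 = g n = 0\<close>, and further tests then give \<open>g = 0\<close>.
\<close>

section \<open>Two-point tests\<close>

text \<open>The value at \<open>c\<close> of the linear interpolation of \<open>g\<close> between
  \<open>i\<close> and \<open>j\<close>. For i < j and i <= c <= j it is the mean of
  \<open>g\<close> under the law on these two points with mean \<open>c\<close>.\<close>

definition two_point_mean :: "nat \<Rightarrow> nat \<Rightarrow> real \<Rightarrow> (nat \<Rightarrow> real) \<Rightarrow> real" where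
  "two_point_mean i j c g = ((real j - c) * g i + (c - real i) * g j) / (real j - real i)"

text \<open>Interpolation is linear in the function and exact on affine functions, so adding a chord
  shifts the result by an amount that depends on \<open>c\<close> but not on \<open>i\<close> and
  \<open>j\<close>.\<close>

lemma two_point_mean_affine:
  assumes "i < j"
  shows "two_point_mean i j c (\<lambda>k. g k + (p + q * real k)) = two_point_mean i j c g + (p + q * c)"
proof -
  have "(real j - c) * (g i + (p + q * real i)) + (c - real i) * (g j + (p + q * real j))
      = ((real j - c) * g i + (c - real i) * g j) + (p + q * c) * (real j - real i)"
    by algebra
  then show ?thesis
    using assms unfolding two_point_mean_def by (simp add: add_divide_distrib)
qed

lemma two_point_mean_nonneg:
  assumes "i < j" "real i \<le> c" "c \<le> real j" "0 \<le> g i" "0 \<le> g j"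
  shows "0 \<le> two_point_mean i j c g"
  using assms unfolding two_point_mean_def by simp

lemma two_point_mean_nonpos:
  assumes "i < j" "real i \<le> c" "c \<le> real j" "g i \<le> 0" "g j \<le> 0"
  shows "two_point_mean i j c g \<le> 0"
  using assms unfolding two_point_mean_def
  by (simp add: divide_nonpos_pos add_nonpos_nonpos mult_nonneg_nonpos)

lemma two_point_mean_zero [simp]: "two_point_mean i j c (\<lambda>k. 0) = 0"
  by (simp add: two_point_mean_def)

text \<open>\<open>A\<close> and \<open>B\<close> stand for \<open>n a\<close> and
  \<open>n b\<close>, and \<open>g\<close> for the deviation of a rule from the random dictator.
  \<open>below\<close> and \<open>above\<close> express that \<open>Lo\<close> speaks for state 0
  and \<open>Hi\<close> for state 1.\<close>

lemma two_point_tests_imp_zero: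
  fixes g :: "nat \<Rightarrow> real" and A B mu :: real
  assumes "1 \<le> A" "A < B" "B \<le> real n - 1" "0 < mu" "mu < 1"
    and below: "mu * (real n - B) < (1 - mu) * (real n - A)"
    and above: "(1 - mu) * A < mu * B"
    and g0: "0 \<le> g 0" and gn: "g n \<le> 0"
    and test: "\<And>i j k l. \<lbrakk>i < j; j \<le> n; k < l; l \<le> n; {i, j} \<inter> {k, l} = {};
        real i \<le> A; A \<le> real j; real k \<le> B; B \<le> real l\<rbrakk>
        \<Longrightarrow> (1 - mu) * two_point_mean i j A g \<le> mu * two_point_mean k l B g"
    and "k \<le> n"
  shows "g k = 0"
proof -
  have n3: "3 \<le> n"
    using assms(1-3) by linarith
  define q where "q = (g n - g 0) / real n"
  define h where "h = (\<lambda>k. g k - (g 0 + q * real k))"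
  define D where "D = mu * (g 0 + q * B) - (1 - mu) * (g 0 + q * A)"
  \<comment> \<open>\<open>D\<close> is the test value of the chord of \<open>g\<close> through \<open>0\<close> and \<open>n\<close>.\<close>
  have h_ends: "h 0 = 0" "h n = 0"
    using n3 by (auto simp: h_def q_def)
  have g_h: "g = (\<lambda>k. h k + (g 0 + q * real k))"
    by (auto simp: h_def)
  \<comment> \<open>The chord contributes the same amount \<open>D\<close> to every test, whatever
    the four points are.\<close>
  have test_h: "(1 - mu) * two_point_mean i j A h \<le> D + mu * two_point_mean k l B h"
    if "i < j" "j \<le> n" "k < l" "l \<le> n" "{i, j} \<inter> {k, l} = {}"
       "real i \<le> A" "A \<le> real j" "real k \<le> B" "B \<le> real l" for i j k l
  proof -
    have "two_point_mean i j A g = two_point_mean i j A h + (g 0 + q * A)"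
         "two_point_mean k l B g = two_point_mean k l B h + (g 0 + q * B)"
      using that by (subst g_h, simp add: two_point_mean_affine)+
    then show ?thesis
      using test[OF that] unfolding D_def by (simp add: distrib_left)
  qed
  \<comment> \<open>The factor \<open>n\<close> clears the denominator of the slope. The coefficient
    of \<open>g 0\<close> is negative by \<open>below\<close> and that of \<open>g n\<close>
    positive by \<open>above\<close>, so both summands are nonpositive.\<close>
  have D_eq: "real n * D = - ((1 - mu) * (real n - A) - mu * (real n - B)) * g 0
      + (mu * B - (1 - mu) * A) * g n"
  proof -
    have "real n * D = mu * (real n * g 0 + (real n * q) * B)
        - (1 - mu) * (real n * g 0 + (real n * q) * A)"
      by (simp add: D_def algebra_simps)
    moreover have "real n * q = g n - g 0"
      using n3 by (simp add: q_def)
    ultimately show ?thesis by (simp only:) (simp add: algebra_simps)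
  qed
  have parts: "- ((1 - mu) * (real n - A) - mu * (real n - B)) * g 0 \<le> 0"
      "(mu * B - (1 - mu) * A) * g n \<le> 0"
    using below above g0 gn by (simp_all add: mult_nonneg_nonpos mult_nonpos_nonneg)
  have "0 \<le> D"
  proof -
    have *: "real (n - 1) = real n - 1" using n3 by simp
    \<comment> \<open>The law given state 0 takes those of the points 1 and n - 1 where
      \<open>h\<close> is nonnegative, the law given state 1 those where it is nonpositive. The
      zeros 0 and n of \<open>h\<close> complete the supports.\<close>
    consider "0 \<le> h 1" "0 \<le> h (n - 1)" | "h 1 \<le> 0" "h (n - 1) \<le> 0"
      | "0 \<le> h 1" "h (n - 1) \<le> 0" | "h 1 \<le> 0" "0 \<le> h (n - 1)" by linarith
    then show ?thesis
    proof cases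
      case 1
      have "(1 - mu) * two_point_mean 1 (n - 1) A h \<le> D + mu * two_point_mean 0 n B h"
        using assms n3 * by (intro test_h) auto
      moreover have "two_point_mean 0 n B h \<le> 0" "0 \<le> two_point_mean 1 (n - 1) A h"
        using 1 assms n3 * h_ends by (auto intro!: two_point_mean_nonneg two_point_mean_nonpos)
      ultimately show ?thesis
        using assms by (smt (verit) mult_nonneg_nonneg mult_nonneg_nonpos)
    next
      case 2
      have "(1 - mu) * two_point_mean 0 n A h \<le> D + mu * two_point_mean 1 (n - 1) B h"
        using assms n3 * by (intro test_h) auto
      moreover have "two_point_mean 1 (n - 1) B h \<le> 0" "0 \<le> two_point_mean 0 n A h"
        using 2 assms n3 * h_ends by (auto intro!: two_point_mean_nonneg two_point_mean_nonpos)
      ultimately show ?thesis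
        using assms by (smt (verit) mult_nonneg_nonneg mult_nonneg_nonpos)
    next
      case 3
      have "(1 - mu) * two_point_mean 1 n A h \<le> D + mu * two_point_mean 0 (n - 1) B h"
        using assms n3 * by (intro test_h) auto
      moreover have "two_point_mean 0 (n - 1) B h \<le> 0" "0 \<le> two_point_mean 1 n A h"
        using 3 assms n3 * h_ends by (auto intro!: two_point_mean_nonneg two_point_mean_nonpos)
      ultimately show ?thesis
        using assms by (smt (verit) mult_nonneg_nonneg mult_nonneg_nonpos)
    next
      case 4
      have "(1 - mu) * two_point_mean 0 (n - 1) A h \<le> D + mu * two_point_mean 1 n B h"
        using assms n3 * by (intro test_h) auto
      moreover have "two_point_mean 1 n B h \<le> 0" "0 \<le> two_point_mean 0 (n - 1) A h"
        using 4 assms n3 * h_ends by (auto intro!: two_point_mean_nonneg two_point_mean_nonpos)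
      ultimately show ?thesis
        using assms by (smt (verit) mult_nonneg_nonneg mult_nonneg_nonpos)
    qed
  qed
  then have "0 \<le> real n * D" by simp
  \<comment> \<open>Two nonpositive summands with a nonnegative sum both vanish.\<close>
  then have "((1 - mu) * (real n - A) - mu * (real n - B)) * g 0 = 0"
      "(mu * B - (1 - mu) * A) * g n = 0"
    using parts D_eq by linarith+
  then have ends: "g 0 = 0" "g n = 0"
    using below above by auto
  define m where "m = n - 1"
  have m: "1 < m" "m < n" "real m = real n - 1"
    using n3 by (auto simp: m_def)
  have pos: "0 < 1 - mu" "0 < real m - A" "0 < real n - A" "0 < real n - B" "0 < B - 1" "0 < A" "0 < B"
    using assms m by auto
  have left_A: "two_point_mean 0 j A g = A * g j / real j"
    and left_B: "two_point_mean 0 j B g = B * g j / real j"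
    and right_A: "two_point_mean j n A g = (real n - A) * g j / (real n - real j)"
    and right_B: "two_point_mean j n B g = (real n - B) * g j / (real n - real j)" for j
    using ends by (auto simp: two_point_mean_def)
  \<comment> \<open>The same four tests, now applied to \<open>g\<close> itself: as \<open>g\<close>
    vanishes at 0 and n, they become linear inequalities in \<open>g 1\<close> and
    \<open>g m\<close>.\<close>
  have t1: "(1 - mu) * two_point_mean 1 m A g \<le> 0"
    using test[of 1 m 0 n] assms m ends by (simp add: left_B)
  have t2: "0 \<le> mu * two_point_mean 1 m B g"
    using test[of 0 n 1 m] assms m ends by (simp add: left_A)
  have t3: "(1 - mu) * ((real n - A) * g 1 / (real n - 1)) \<le> mu * (B * g m / real m)"
    using test[of 1 n 0 m] assms m by (simp add: right_A left_B)
  have t4: "(1 - mu) * (A * g m / real m) \<le> mu * ((real n - B) * g 1 / (real n - 1))"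
    using test[of 0 m 1 n] assms m by (simp add: left_A right_B)
  have t1': "(real m - A) * g 1 + (A - 1) * g m \<le> 0"
    using t1 pos m by (simp add: two_point_mean_def mult_le_0_iff divide_le_0_iff)
  have t2': "0 \<le> (real m - B) * g 1 + (B - 1) * g m"
    using t2 assms m by (simp add: two_point_mean_def zero_le_mult_iff zero_le_divide_iff)
  have "((1 - mu) * (real n - A)) * g 1 / real m \<le> (mu * B) * g m / real m"
    using t3 m by (simp add: mult.assoc)
  then have t3': "((1 - mu) * (real n - A)) * g 1 \<le> (mu * B) * g m"
    using m by (simp add: divide_le_cancel)
  have "((1 - mu) * A) * g m / real m \<le> (mu * (real n - B)) * g 1 / real m"
    using t4 m by (simp add: mult.assoc)
  then have t4': "((1 - mu) * A) * g m \<le> (mu * (real n - B)) * g 1"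
    using m by (simp add: divide_le_cancel)
  have coeff: "0 < (1 - mu) * (real n - A)" "0 < mu * B" "0 < (1 - mu) * A" "0 < mu * (real n - B)"
    using pos assms by simp_all
  have "g 1 = 0"
  proof (rule ccontr)
    assume "g 1 \<noteq> 0"
    \<comment> \<open>If \<open>g 1\<close> is positive, \<open>t3'\<close> makes \<open>g m\<close>
      positive, against \<open>t1'\<close>; if it is negative, \<open>t4'\<close> makes
      \<open>g m\<close> negative, against \<open>t2'\<close>. Here \<open>m - A\<close> and
      \<open>B - 1\<close> are strictly positive, while \<open>A - 1\<close> and
      \<open>m - B\<close> may be 0.\<close>
    then consider "0 < g 1" | "g 1 < 0" by linarith
    then show False
    proof cases
      case 1
      then have "0 < (mu * B) * g m"
        using t3' coeff by (meson less_le_trans mult_pos_pos)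
      then have "0 < g m" using coeff(2) mult_nonneg_nonpos[of "mu * B" "g m"] by linarith
      then have "0 \<le> (A - 1) * g m" "0 < (real m - A) * g 1"
        using 1 pos assms by simp_all
      then show False using t1' by linarith
    next
      case 2
      then have "((1 - mu) * A) * g m < 0"
        using t4' coeff by (meson le_less_trans mult_pos_neg)
      then have "g m < 0" using coeff(3) mult_nonneg_nonneg[of "(1 - mu) * A" "g m"] by linarith
      then have "(B - 1) * g m < 0" "(real m - B) * g 1 \<le> 0"
        using 2 pos assms m by (simp_all add: mult_pos_neg mult_nonneg_nonpos)
      then show False using t2' by linarith
    qed
  qed
  moreover have "g m = 0"
    using t3' t4' coeff pos assms(4) \<open>g 1 = 0\<close> by (auto simp: zero_le_mult_iff mult_le_0_iff)
  \<comment> \<open>With \<open>g\<close> zero at 0, 1, m and n, a single point can be tested alone: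
    \<open>k\<close> in the support given state 0 yields an upper bound, given state 1 a lower
    bound. Its partner, 0 or n, lies on the other side of the mean, and the other law uses two of
    the remaining zeros.\<close>
  moreover have "g k = 0" if "1 < k" "k < m" for k
  proof (rule antisym)
    have kn: "0 < real n - real k" "0 < real k" using that m by auto
    show "g k \<le> 0"
    proof (cases "real k \<le> A")
      case True
      have "(1 - mu) * ((real n - A) * g k / (real n - real k)) \<le> 0"
        using test[of k n 0 m] True that assms m \<open>g m = 0\<close> by (simp add: right_A left_B)
      then show ?thesis using pos kn by (simp add: mult_le_0_iff divide_le_0_iff)
    next
      case False
      have "(1 - mu) * (A * g k / real k) \<le> 0"
        using test[of 0 k 1 n] False that assms m \<open>g 1 = 0\<close> by (simp add: left_A right_B)
      then show ?thesis using pos kn by (simp add: mult_le_0_iff divide_le_0_iff)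
    qed
    show "0 \<le> g k"
    proof (cases "B \<le> real k")
      case True
      have "0 \<le> mu * (B * g k / real k)"
        using test[of 1 n 0 k] True that assms m \<open>g 1 = 0\<close> by (simp add: right_A left_B)
      then show ?thesis using pos assms kn by (simp add: zero_le_mult_iff zero_le_divide_iff)
    next
      case False
      have "0 \<le> mu * ((real n - B) * g k / (real n - real k))"
        using test[of 0 m k n] False that assms m \<open>g m = 0\<close> by (simp add: left_A right_B)
      then show ?thesis using pos assms kn by (simp add: zero_le_mult_iff zero_le_divide_iff)
    qed
  qed
  moreover have "k = 0 \<or> k = 1 \<or> 1 < k \<and> k < m \<or> k = m \<or> k = n"
    using \<open>k \<le> n\<close> m_def by linarith
  ultimately show ?thesis
    using ends by blast
qed

section \<open>Laws of the signal count\<close>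

text \<open>Laws are functions on all naturals that vanish beyond \<open>n\<close>, so that they
  form a closed set in the product topology and equal laws are equal functions.\<close>

definition count_laws :: "nat \<Rightarrow> real \<Rightarrow> (nat \<Rightarrow> real) set" where
  "count_laws n c = {x. (\<forall>k. 0 \<le> x k) \<and> (\<forall>k>n. x k = 0) \<and> (\<Sum>k\<le>n. x k) = 1 \<and>
     (\<Sum>k\<le>n. real k * x k) = c}"

text \<open>Throughout, \<open>x\<close> is the law given state 0, \<open>y\<close> the law given
  state 1, and \<open>F k\<close> is the rule at k / n.\<close>

definition correct_of_laws :: "nat \<Rightarrow> real \<Rightarrow> (nat \<Rightarrow> real) \<Rightarrow> (nat \<Rightarrow> real) \<Rightarrow> (nat \<Rightarrow> real) \<Rightarrow> real" where
  "correct_of_laws n mu F x y = mu * (\<Sum>k\<le>n. F k * y k) + (1 - mu) * (\<Sum>k\<le>n. (1 - F k) * x k)"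

definition bayes_of_laws :: "nat \<Rightarrow> real \<Rightarrow> (nat \<Rightarrow> real) \<Rightarrow> (nat \<Rightarrow> real) \<Rightarrow> real" where
  "bayes_of_laws n mu x y = (\<Sum>k\<le>n. max ((1 - mu) * x k) (mu * y k))"

section \<open>Compactness of the laws and attainment of the minimum\<close>

lemma compact_count_laws: "compact (count_laws n c)"
proof -
  \<comment> \<open>By Tychonoff the unit cube is compact; the laws form a closed subset of
    it.\<close>
  have "compactin (product_topology (\<lambda>_. euclideanreal) UNIV) (PiE UNIV (\<lambda>_::nat. {0..1::real}))"
    by (subst compactin_PiE) (auto simp: compactin_euclidean_iff)
  then have box: "compact (PiE UNIV (\<lambda>_::nat. {0..1::real}))"
    by (simp add: euclidean_product_topology compactin_euclidean_iff)
  have eq: "count_laws n c = (\<Inter>k. {x. 0 \<le> x k}) \<inter> (\<Inter>k\<in>{n<..}. {x. x k = 0}) \<inter>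
      {x. (\<Sum>k\<le>n. x k) = 1} \<inter> {x. (\<Sum>k\<le>n. real k * x k) = c}"
    by (auto simp: count_laws_def)
  have "closed (count_laws n c)"
    unfolding eq by (intro closed_Int closed_INT ballI closed_Collect_le closed_Collect_eq
        continuous_intros continuous_on_product_coordinates)
  moreover have "count_laws n c \<subseteq> PiE UNIV (\<lambda>_::nat. {0..1::real})"
  proof
    fix x assume x: "x \<in> count_laws n c"
    have "x k \<le> 1" for k
    proof (cases "k \<le> n")
      case True
      then have "x k \<le> (\<Sum>k\<le>n. x k)"
        using x by (intro member_le_sum) (auto simp: count_laws_def)
      then show ?thesis using x by (simp add: count_laws_def)
    next
      case False
      then show ?thesis using x by (simp add: count_laws_def)
    qed
    then show "x \<in> PiE UNIV (\<lambda>_::nat. {0..1::real})"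
      using x by (auto simp: count_laws_def)
  qed
  ultimately show ?thesis
    using box by (metis closed_Int_compact inf.absorb_iff1)
qed

text \<open>Each maximum lies between \<open>mu * y k\<close> and the sum of its two arguments.
  Positivity makes the ratio continuous; the bound 1 makes it at least the probability of a correct
  guess.\<close>

lemma bayes_of_laws_bounds:
  assumes "x \<in> count_laws n c" "y \<in> count_laws n d" "0 < mu" "mu < 1"
  shows "0 < bayes_of_laws n mu x y" "bayes_of_laws n mu x y \<le> 1"
proof -
  have "mu = (\<Sum>k\<le>n. mu * y k)"
    using assms(2) by (simp add: count_laws_def flip: sum_distrib_left)
  also have "\<dots> \<le> bayes_of_laws n mu x y"
    unfolding bayes_of_laws_def by (intro sum_mono) simp
  finally show "0 < bayes_of_laws n mu x y" using assms by linarith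
  have "bayes_of_laws n mu x y \<le> (\<Sum>k\<le>n. (1 - mu) * x k + mu * y k)"
    unfolding bayes_of_laws_def using assms
    by (intro sum_mono) (auto simp: count_laws_def)
  also have "\<dots> = 1"
    using assms by (simp add: sum.distrib count_laws_def flip: sum_distrib_left)
  finally show "bayes_of_laws n mu x y \<le> 1" .
qed

text \<open>With disjoint supports the count reveals the state: in each maximum one argument is 0,
  so the maximum is the sum.\<close>

lemma bayes_of_laws_disjoint:
  assumes "x \<in> count_laws n c" "y \<in> count_laws n d" "0 < mu" "mu < 1"
    and "\<And>k. x k = 0 \<or> y k = 0"
  shows "bayes_of_laws n mu x y = 1"
proof -
  have "max ((1 - mu) * x k) (mu * y k) = (1 - mu) * x k + mu * y k" for k
    using assms(5)[of k] assms(1-4) by (auto simp: count_laws_def)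
  then show ?thesis
    using assms unfolding bayes_of_laws_def
    by (simp add: sum.distrib count_laws_def flip: sum_distrib_left)
qed

lemma ratio_of_laws_attains_min:
  assumes "count_laws n c \<noteq> {}" "count_laws n d \<noteq> {}" "0 < mu" "mu < 1"
  shows "\<exists>x\<in>count_laws n c. \<exists>y\<in>count_laws n d. \<forall>x'\<in>count_laws n c. \<forall>y'\<in>count_laws n d.
    correct_of_laws n mu F x y / bayes_of_laws n mu x y
      \<le> correct_of_laws n mu F x' y' / bayes_of_laws n mu x' y'"
proof -
  let ?S = "count_laws n c \<times> count_laws n d"
  have coord: "continuous_on S (\<lambda>p. fst p k)" "continuous_on S (\<lambda>p. snd p k)"
    for S :: "((nat \<Rightarrow> real) \<times> (nat \<Rightarrow> real)) set" and k
    by (rule continuous_on_product_then_coordinatewise[OF continuous_on_fst[OF continuous_on_id]],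
        rule continuous_on_product_then_coordinatewise[OF continuous_on_snd[OF continuous_on_id]])
  have "compact ?S"
    by (intro compact_Times compact_count_laws)
  moreover have "?S \<noteq> {}" using assms by simp
  moreover have "continuous_on ?S
      (\<lambda>p. correct_of_laws n mu F (fst p) (snd p) / bayes_of_laws n mu (fst p) (snd p))"
    unfolding correct_of_laws_def
  proof (intro continuous_intros coord ballI)
    show "continuous_on ?S (\<lambda>p. bayes_of_laws n mu (fst p) (snd p))"
      unfolding bayes_of_laws_def by (intro continuous_intros coord)
    show "bayes_of_laws n mu (fst p) (snd p) \<noteq> 0" if "p \<in> ?S" for p
      using that bayes_of_laws_bounds(1)[of "fst p" n c "snd p" d mu] assms by auto
  qed
  ultimately obtain p where "p \<in> ?S" "\<forall>p'\<in>?S.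
      correct_of_laws n mu F (fst p) (snd p) / bayes_of_laws n mu (fst p) (snd p)
      \<le> correct_of_laws n mu F (fst p') (snd p') / bayes_of_laws n mu (fst p') (snd p')"
    using continuous_attains_inf by blast
  then show ?thesis by force
qed

section \<open>Two-point laws and the deviation from the random dictator\<close>

definition two_point_law :: "nat \<Rightarrow> nat \<Rightarrow> real \<Rightarrow> nat \<Rightarrow> real" where
  "two_point_law i j c = (\<lambda>k. if k = i then (real j - c) / (real j - real i)
     else if k = j then (c - real i) / (real j - real i) else 0)"

lemma sum_two_point_law:
  assumes "i < j" "j \<le> n"
  shows "(\<Sum>k\<le>n. g k * two_point_law i j c k) = two_point_mean i j c g"
proof -
  have "(\<Sum>k\<le>n. g k * two_point_law i j c k) = (\<Sum>k\<in>{i,j}. g k * two_point_law i j c k)"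
    using assms by (intro sum.mono_neutral_right) (auto simp: two_point_law_def)
  also have "\<dots> = two_point_mean i j c g"
    using assms by (simp add: two_point_law_def two_point_mean_def add_divide_distrib mult.commute)
  finally show ?thesis .
qed

lemma two_point_law_in_count_laws:
  assumes "i < j" "j \<le> n" "real i \<le> c" "c \<le> real j"
  shows "two_point_law i j c \<in> count_laws n c"
proof -
  \<comment> \<open>The constant 1 gives the total mass and the identity gives the mean.\<close>
  have "two_point_mean i j c (\<lambda>k. 0 + (1 + 0 * real k)) = 1"
       "two_point_mean i j c (\<lambda>k. 0 + (0 + 1 * real k)) = c"
    using assms by (subst two_point_mean_affine; simp)+
  then show ?thesis
    using sum_two_point_law[of i j n "\<lambda>k. 1" c] sum_two_point_law[of i j n real c] assms
    by (auto simp: count_laws_def) (auto simp: two_point_law_def)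
qed

lemma two_point_law_disjoint:
  assumes "{i, j} \<inter> {k, l} = {}"
  shows "two_point_law i j c m = 0 \<or> two_point_law k l d m = 0"
  using assms by (auto simp: two_point_law_def)

text \<open>The random dictator is linear in the count, so its success depends on the two means
  alone; what remains is linear in the deviation of \<open>F\<close> from it.\<close>

lemma correct_of_laws_eq:
  assumes "x \<in> count_laws n (real n * a)" "y \<in> count_laws n (real n * b)" "0 < n"
  shows "correct_of_laws n mu F x y = (1 - mu) * (1 - a) + mu * b
    + (mu * (\<Sum>k\<le>n. (F k - real k / real n) * y k) - (1 - mu) * (\<Sum>k\<le>n. (F k - real k / real n) * x k))"
proof -
  have mean: "(\<Sum>k\<le>n. real k / real n * x k) = a" "(\<Sum>k\<le>n. real k / real n * y k) = b"
    using assms by (simp_all add: count_laws_def flip: sum_divide_distrib)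
  have "(\<Sum>k\<le>n. (1 - F k) * x k) = 1 - (\<Sum>k\<le>n. F k * x k)"
    using assms by (simp add: left_diff_distrib sum_subtractf count_laws_def)
  moreover have "(\<Sum>k\<le>n. (F k - real k / real n) * x k) = (\<Sum>k\<le>n. F k * x k) - a"
    "(\<Sum>k\<le>n. (F k - real k / real n) * y k) = (\<Sum>k\<le>n. F k * y k) - b"
    using mean by (simp_all only: left_diff_distrib sum_subtractf)
  ultimately show ?thesis
    unfolding correct_of_laws_def by (simp only:) (simp add: algebra_simps)
qed

section \<open>From information structures to laws\<close>

lemma measure_pmf_split:
  "measure_pmf.prob p {x. P x} = measure_pmf.prob p {x. P x \<and> Q x} + measure_pmf.prob p {x. P x \<and> \<not> Q x}"
proof -
  have "{x. P x} = {x. P x \<and> Q x} \<union> {x. P x \<and> \<not> Q x}" by auto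
  then show ?thesis
    by (simp only:) (rule measure_pmf.finite_measure_Union, auto)
qed

lemma not_Hi_iff: "z \<noteq> Hi \<longleftrightarrow> z = Lo"
  by (cases z) auto

text \<open>The posteriors and the prior fix the joint probabilities of state and signal for each
  agent, which turns the conditional constraints into linear equations.\<close>

lemma info_structures_iff:
  assumes "0 < mu" "mu < 1" "p1 < mu" "mu < p2"
  shows "\<pi> \<in> info_structures n mu p1 p2 \<longleftrightarrow>
     (\<forall>x \<in> set_pmf \<pi>. length (snd x) = n) \<and> measure_pmf.prob \<pi> {x. fst x} = mu \<and>
     (\<forall>i<n. measure_pmf.prob \<pi> {x. fst x \<and> snd x ! i = Hi} = mu * prob_Hi_given_1 mu p1 p2 \<and>
            measure_pmf.prob \<pi> {x. \<not> fst x \<and> snd x ! i = Hi} = (1 - mu) * prob_Hi_given_0 mu p1 p2)"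
proof -
  \<comment> \<open>\<open>h\<close> is the unconditional probability of \<open>Hi\<close>, the only
    solution of mu = p2 h + p1 (1 - h). It lies strictly between 0 and 1, so both signals
    occur.\<close>
  define h where "h = (mu - p1) / (p2 - p1)"
  have "h * (p2 - p1) = mu - p1"
    using assms by (simp add: h_def)
  then have "mu = p2 * h + p1 * (1 - h)"
    by (simp add: algebra_simps)
  moreover have "0 < h" "h < 1"
    using assms by (auto simp: h_def)
  ultimately have h: "0 < h" "h < 1" "mu = p2 * h + p1 * (1 - h)" by simp_all
  have ab: "mu * prob_Hi_given_1 mu p1 p2 = p2 * h" "(1 - mu) * prob_Hi_given_0 mu p1 p2 = (1 - p2) * h"
    using assms by (auto simp: h_def prob_Hi_given_1_def prob_Hi_given_0_def)
  have agent: "(0 < measure_pmf.prob \<pi> {x. snd x ! i = Lo} \<and> 0 < measure_pmf.prob \<pi> {x. snd x ! i = Hi} \<and>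
      measure_pmf.prob \<pi> {x. fst x \<and> snd x ! i = Lo} / measure_pmf.prob \<pi> {x. snd x ! i = Lo} = p1 \<and>
      measure_pmf.prob \<pi> {x. fst x \<and> snd x ! i = Hi} / measure_pmf.prob \<pi> {x. snd x ! i = Hi} = p2) \<longleftrightarrow>
      measure_pmf.prob \<pi> {x. fst x \<and> snd x ! i = Hi} = p2 * h \<and>
      measure_pmf.prob \<pi> {x. \<not> fst x \<and> snd x ! i = Hi} = (1 - p2) * h"
    if "measure_pmf.prob \<pi> {x. fst x} = mu" for i
  proof -
    define TH FH TL L where
      "TH = measure_pmf.prob \<pi> {x. fst x \<and> snd x ! i = Hi}" and
      "FH = measure_pmf.prob \<pi> {x. \<not> fst x \<and> snd x ! i = Hi}" and
      "TL = measure_pmf.prob \<pi> {x. fst x \<and> snd x ! i = Lo}" and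
      "L = measure_pmf.prob \<pi> {x. snd x ! i = Lo}"
    have H: "measure_pmf.prob \<pi> {x. snd x ! i = Hi} = TH + FH"
      using measure_pmf_split[of \<pi> "\<lambda>x. snd x ! i = Hi" fst]
      by (simp add: TH_def FH_def conj_commute)
    have T: "mu = TH + TL"
      using measure_pmf_split[of \<pi> fst "\<lambda>x. snd x ! i = Hi"] that
      by (simp add: TH_def TL_def not_Hi_iff)
    have tot: "1 = (TH + FH) + L"
      using measure_pmf_split[of \<pi> "\<lambda>_. True" "\<lambda>x. snd x ! i = Hi"]
      by (simp add: H L_def not_Hi_iff)
    have "(0 < L \<and> 0 < TH + FH \<and> TL / L = p1 \<and> TH / (TH + FH) = p2) \<longleftrightarrow> TH = p2 * h \<and> FH = (1 - p2) * h"
    proof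
      assume *: "0 < L \<and> 0 < TH + FH \<and> TL / L = p1 \<and> TH / (TH + FH) = p2"
      then have 1: "TL = p1 * L" "TH = p2 * (TH + FH)" by (metis nonzero_mult_div_cancel_right divide_eq_eq less_irrefl)+
      then have "mu = p2 * (TH + FH) + p1 * (1 - (TH + FH))"
        using T tot by auto
      then have "(p2 - p1) * (TH + FH) = (p2 - p1) * h"
        using h(3) by (simp add: algebra_simps)
      then have "TH + FH = h" using assms by simp
      then show "TH = p2 * h \<and> FH = (1 - p2) * h"
        using 1 by (auto simp: algebra_simps)
    next
      assume *: "TH = p2 * h \<and> FH = (1 - p2) * h"
      then have "TH + FH = h" by (auto simp: algebra_simps)
      moreover then have "L = 1 - h" "TL = p1 * (1 - h)"
        using tot T h * by auto
      ultimately show "0 < L \<and> 0 < TH + FH \<and> TL / L = p1 \<and> TH / (TH + FH) = p2"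
        using h * by auto
    qed
    then show ?thesis
      by (simp only: H flip: TH_def FH_def TL_def L_def)
  qed
  show ?thesis
    unfolding info_structures_def mem_Collect_eq ab cond_prob_def case_prod_beta space_measure_pmf
    by (simp add: agent cong: conj_cong)
qed

section \<open>The induced law of the fraction of \<open>Hi\<close> signals\<close>

lemma finite_fractions: "finite (fractions n)"
  by (simp add: fractions_def)

lemma sum_fractions:
  assumes "0 < n"
  shows "(\<Sum>\<nu>\<in>fractions n. g \<nu>) = (\<Sum>k\<le>n. g (real k / real n))"
proof -
  have "inj_on (\<lambda>k. real k / real n) {0..n}"
    using assms by (auto simp: inj_on_def)
  then show ?thesis
    by (simp add: fractions_def sum.reindex atMost_atLeast0)
qed

lemma hi_fraction_in_fractions: "hi_fraction s \<in> fractions (length s)"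
proof -
  have "card {i. i < length s \<and> s ! i = Hi} \<le> card {..<length s}"
    by (intro card_mono) auto
  then show ?thesis by (auto simp: fractions_def hi_fraction_def)
qed

lemma set_pmf_hat:
  assumes "\<forall>x \<in> set_pmf \<pi>. length (snd x) = n"
  shows "set_pmf (hat \<pi>) \<subseteq> UNIV \<times> fractions n"
  using assms hi_fraction_in_fractions by (fastforce simp: hat_def)

lemma expectation_hat_state:
  assumes "\<forall>x \<in> set_pmf \<pi>. length (snd x) = n"
  shows "measure_pmf.expectation (hat \<pi>) (\<lambda>x. of_bool (fst x = w) * g (snd x))
    = (\<Sum>\<nu>\<in>fractions n. g \<nu> * pmf (hat \<pi>) (w, \<nu>))"
proof -
  have "measure_pmf.expectation (hat \<pi>) (\<lambda>x. of_bool (fst x = w) * g (snd x))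
    = (\<Sum>x\<in>{w} \<times> fractions n. of_bool (fst x = w) * g (snd x) * pmf (hat \<pi>) x)"
    using set_pmf_hat[OF assms] by (intro integral_measure_pmf_real) (auto simp: finite_fractions)
  also have "\<dots> = (\<Sum>w'\<in>{w}. \<Sum>\<nu>\<in>fractions n. of_bool (w' = w) * g \<nu> * pmf (hat \<pi>) (w', \<nu>))"
    by (simp only: sum.cartesian_product) (simp add: case_prod_beta)
  finally show ?thesis by simp
qed

lemma pmf_hat_cond:
  assumes "measure_pmf.prob \<pi> {x. fst x = w} \<noteq> 0"
  shows "pmf (hat_cond w \<pi>) \<nu> = pmf (hat \<pi>) (w, \<nu>) / measure_pmf.prob \<pi> {x. fst x = w}"
proof -
  have m: "measure_pmf.prob (hat \<pi>) {x. fst x = w} = measure_pmf.prob \<pi> {x. fst x = w}"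
    by (simp add: hat_def vimage_def case_prod_beta)
  then have ne: "set_pmf (hat \<pi>) \<inter> {x. fst x = w} \<noteq> {}"
    using assms by (metis measure_Int_set_pmf inf_commute measure_empty)
  let ?C = "cond_pmf (hat \<pi>) {x. fst x = w}"
  have "pmf (hat_cond w \<pi>) \<nu> = measure_pmf.prob ?C (snd -` {\<nu>})"
    by (simp add: hat_cond_def pmf_map)
  also have "\<dots> = measure_pmf.prob ?C (snd -` {\<nu>} \<inter> set_pmf ?C)"
    by (simp add: measure_Int_set_pmf)
  also have "\<dots> = measure_pmf.prob ?C ({(w, \<nu>)} \<inter> set_pmf ?C)"
    by (rule arg_cong[where f = "measure_pmf.prob ?C"]) (auto simp: set_cond_pmf[OF ne])
  also have "\<dots> = pmf ?C (w, \<nu>)"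
    by (simp add: measure_Int_set_pmf measure_pmf_single)
  finally show ?thesis
    by (simp add: pmf_cond[OF ne] m)
qed

definition state_law :: "nat \<Rightarrow> outcome pmf \<Rightarrow> bool \<Rightarrow> nat \<Rightarrow> real" where
  "state_law n \<pi> w k = (if k \<le> n then pmf (hat_cond w \<pi>) (real k / real n) else 0)"

lemma prob_correct_eq_laws:
  assumes "\<pi> \<in> info_structures n mu p1 p2" "0 < mu" "mu < 1" "p1 < mu" "mu < p2" "0 < n"
  shows "prob_correct mu f \<pi> =
    correct_of_laws n mu (\<lambda>k. f (real k / real n)) (state_law n \<pi> False) (state_law n \<pi> True)"
proof -
  have len: "\<forall>x \<in> set_pmf \<pi>. length (snd x) = n" and T: "measure_pmf.prob \<pi> {x. fst x} = mu"
    using assms by (simp_all add: info_structures_iff)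
  have F: "measure_pmf.prob \<pi> {x. \<not> fst x} = 1 - mu"
    using measure_pmf_split[of \<pi> "\<lambda>_. True" fst] T by simp
  have "measure_pmf.prob \<pi> {x. fst x = w} \<noteq> 0" for w
    using T F assms by (cases w) auto
  then have "set_pmf (hat_cond w \<pi>) \<subseteq> fractions n" for w
    using set_pmf_hat[OF len] by (auto simp: pmf_hat_cond set_pmf_iff)
  then have "measure_pmf.expectation (hat_cond w \<pi>) g = (\<Sum>k\<le>n. g (real k / real n) * state_law n \<pi> w k)" for w g
    by (subst integral_measure_pmf_real[of "fractions n"])
      (auto simp: finite_fractions sum_fractions[OF \<open>0 < n\<close>] state_law_def)
  then show ?thesis
    by (simp add: prob_correct_def correct_of_laws_def)
qed

lemma bayes_prob_correct_eq_laws: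
  assumes "\<pi> \<in> info_structures n mu p1 p2" "0 < mu" "mu < 1" "p1 < mu" "mu < p2" "0 < n"
  shows "bayes_prob_correct \<pi> = bayes_of_laws n mu (state_law n \<pi> False) (state_law n \<pi> True)"
proof -
  have len: "\<forall>x \<in> set_pmf \<pi>. length (snd x) = n" and T: "measure_pmf.prob \<pi> {x. fst x} = mu"
    using assms by (simp_all add: info_structures_iff)
  have F: "measure_pmf.prob \<pi> {x. \<not> fst x} = 1 - mu"
    using measure_pmf_split[of \<pi> "\<lambda>_. True" fst] T by simp
  let ?H = "hat \<pi>"
  have single: "{x. fst x = w \<and> snd x = \<nu>} = {(w, \<nu>)}" for w :: bool and \<nu> :: real by auto
  have pair: "measure_pmf.prob ?H {x. snd x = \<nu>} = pmf ?H (True, \<nu>) + pmf ?H (False, \<nu>)" for \<nu>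
    using measure_pmf_split[of ?H "\<lambda>x. snd x = \<nu>" "\<lambda>x. fst x = True"]
      single[of True \<nu>] single[of False \<nu>]
    by (simp add: conj_commute measure_pmf_single)
  have "bayes_prob_correct \<pi> = (\<Sum>\<nu>\<in>fractions n. max (pmf ?H (False, \<nu>)) (pmf ?H (True, \<nu>)))"
  proof -
    \<comment> \<open>Posterior times marginal is the joint mass. If the marginal
      \<open>v + u\<close> is 0, then so are \<open>u\<close> and \<open>v\<close>, and both sides
      are 0.\<close>
    have max: "max (u / (v + u)) (v / (v + u)) * (v + u) = max u v" if "0 \<le> u" "0 \<le> v" for u v :: real
      using that by (cases "v + u = 0") (auto simp: max_mult_distrib_right)
    have "set_pmf (map_pmf snd ?H) \<subseteq> fractions n"
      using set_pmf_hat[OF len] by auto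
    then have "bayes_prob_correct \<pi> = (\<Sum>\<nu>\<in>fractions n.
        max \<P>(x in measure_pmf ?H. fst x = False \<bar> snd x = \<nu>) \<P>(x in measure_pmf ?H. fst x = True \<bar> snd x = \<nu>)
         * pmf (map_pmf snd ?H) \<nu>)"
      unfolding bayes_prob_correct_def
      by (intro integral_measure_pmf_real) (auto simp: finite_fractions)
    also have "\<dots> = (\<Sum>\<nu>\<in>fractions n. max (pmf ?H (False, \<nu>)) (pmf ?H (True, \<nu>)))"
    proof (rule sum.cong[OF refl])
      fix \<nu>
      have "pmf (map_pmf snd ?H) \<nu> = pmf ?H (True, \<nu>) + pmf ?H (False, \<nu>)"
        using pair[of \<nu>] by (simp add: pmf_map vimage_def)
      moreover have "\<P>(x in measure_pmf ?H. fst x = w \<bar> snd x = \<nu>) =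
          pmf ?H (w, \<nu>) / (pmf ?H (True, \<nu>) + pmf ?H (False, \<nu>))" for w
        using pair[of \<nu>] single[of w \<nu>] by (simp add: cond_prob_def measure_pmf_single del: fst_conv)
      ultimately show "max \<P>(x in measure_pmf ?H. fst x = False \<bar> snd x = \<nu>) \<P>(x in measure_pmf ?H. fst x = True \<bar> snd x = \<nu>)
         * pmf (map_pmf snd ?H) \<nu> = max (pmf ?H (False, \<nu>)) (pmf ?H (True, \<nu>))"
        by (simp only:) (simp add: max)
    qed
    finally show ?thesis .
  qed
  also have "\<dots> = bayes_of_laws n mu (state_law n \<pi> False) (state_law n \<pi> True)"
    using assms T F
    by (auto simp: bayes_of_laws_def sum_fractions state_law_def pmf_hat_cond intro!: sum.cong)
  finally show ?thesis .
qed

text \<open>The count is a sum of indicators over agents, so linearity of expectation gives its mean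
  however the signals are correlated.\<close>

lemma state_law_in_count_laws:
  assumes "\<pi> \<in> info_structures n mu p1 p2" "0 < mu" "mu < 1" "p1 < mu" "mu < p2" "0 < n"
  shows "state_law n \<pi> False \<in> count_laws n (real n * prob_Hi_given_0 mu p1 p2)"
    and "state_law n \<pi> True \<in> count_laws n (real n * prob_Hi_given_1 mu p1 p2)"
proof -
  have len: "\<forall>x \<in> set_pmf \<pi>. length (snd x) = n" and T: "measure_pmf.prob \<pi> {x. fst x} = mu"
    and HT: "\<And>i. i < n \<Longrightarrow> measure_pmf.prob \<pi> {x. fst x \<and> snd x ! i = Hi} = mu * prob_Hi_given_1 mu p1 p2"
    and HF: "\<And>i. i < n \<Longrightarrow> measure_pmf.prob \<pi> {x. \<not> fst x \<and> snd x ! i = Hi} = (1 - mu) * prob_Hi_given_0 mu p1 p2"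
    using assms by (simp_all add: info_structures_iff)
  have F: "measure_pmf.prob \<pi> {x. \<not> fst x} = 1 - mu"
    using measure_pmf_split[of \<pi> "\<lambda>_. True" fst] T by simp
  have law: "state_law n \<pi> w \<in> count_laws n (real n * c)"
    if m: "measure_pmf.prob \<pi> {x. fst x = w} = m" "m \<noteq> 0"
      and c: "\<And>i. i < n \<Longrightarrow> measure_pmf.prob \<pi> {x. fst x = w \<and> snd x ! i = Hi} = m * c" for w m c
  proof -
    have "(\<Sum>k\<le>n. pmf (hat \<pi>) (w, real k / real n)) =
        measure_pmf.expectation (hat \<pi>) (\<lambda>x. of_bool (fst x = w) * 1)"
      using expectation_hat_state[OF len, of w "\<lambda>_. 1"] by (simp add: sum_fractions assms)
    also have "\<dots> = measure_pmf.expectation \<pi> (\<lambda>x. indicator {x. fst x = w} x)"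
      by (auto simp: hat_def case_prod_beta indicator_def intro!: Bochner_Integration.integral_cong)
    finally have tot: "(\<Sum>k\<le>n. pmf (hat \<pi>) (w, real k / real n)) = m"
      using m by simp
    have "(\<Sum>k\<le>n. real k * pmf (hat \<pi>) (w, real k / real n)) =
        measure_pmf.expectation (hat \<pi>) (\<lambda>x. of_bool (fst x = w) * (real n * snd x))"
      using assms by (simp add: expectation_hat_state[OF len] sum_fractions)
    also have "\<dots> = measure_pmf.expectation \<pi> (\<lambda>x. of_bool (fst x = w) * (real n * hi_fraction (snd x)))"
      by (simp add: hat_def case_prod_beta)
    also have "\<dots> = measure_pmf.expectation \<pi> (\<lambda>x. \<Sum>i<n. indicator {x. fst x = w \<and> snd x ! i = Hi} x)"
    proof (intro integral_cong_AE AE_pmfI)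
      fix x assume "x \<in> set_pmf \<pi>"
      then have l: "length (snd x) = n" using len by blast
      have "real n * hi_fraction (snd x) = real (card {i\<in>{..<n}. snd x ! i = Hi})"
        using assms l by (simp add: hi_fraction_def)
      also have "\<dots> = (\<Sum>i<n. of_bool (snd x ! i = Hi))"
        by (simp add: sum_of_bool_eq Int_def)
      finally show "of_bool (fst x = w) * (real n * hi_fraction (snd x)) =
          (\<Sum>i<n. indicator {x. fst x = w \<and> snd x ! i = Hi} x)"
        by (simp add: indicator_def of_bool_def)
    qed auto
    also have "\<dots> = (\<Sum>i<n. measure_pmf.prob \<pi> {x. fst x = w \<and> snd x ! i = Hi})"
      by (subst Bochner_Integration.integral_sum) (auto simp: measure_pmf.integrable_const_bound[where B = 1])
    also have "\<dots> = m * (real n * c)"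
      using c by simp
    finally have mean: "(\<Sum>k\<le>n. real k * pmf (hat \<pi>) (w, real k / real n)) = m * (real n * c)" .
    have "(\<Sum>k\<le>n. state_law n \<pi> w k) = 1"
      using tot m by (simp add: state_law_def pmf_hat_cond flip: sum_divide_distrib)
    moreover have "(\<Sum>k\<le>n. real k * state_law n \<pi> w k) = real n * c"
      using mean m by (simp add: state_law_def pmf_hat_cond flip: sum_divide_distrib)
    ultimately show ?thesis
      by (simp add: count_laws_def) (simp add: state_law_def)
  qed
  show "state_law n \<pi> False \<in> count_laws n (real n * prob_Hi_given_0 mu p1 p2)"
    using law[of False "1 - mu"] F HF assms by simp
  show "state_law n \<pi> True \<in> count_laws n (real n * prob_Hi_given_1 mu p1 p2)"
    using law[of True mu] T HT assms by simp
qed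

section \<open>From laws to information structures\<close>

text \<open>Shifting modulo \<open>n\<close> permutes the indices, so exactly \<open>k\<close> of
  them land below \<open>k\<close>.\<close>

lemma card_cyclic_less:
  assumes "k \<le> n"
  shows "card {i\<in>{..<n}. (i + r) mod n < k} = k"
proof -
  have inj: "inj_on (\<lambda>i. (i + r) mod n) {..<n}"
  proof (rule linorder_inj_onI)
    fix i j assume *: "i < j" "i \<in> {..<n}" "j \<in> {..<n}"
    then have "\<not> n dvd (j + r) - (i + r)"
      by (auto dest: dvd_imp_le)
    then show "(i + r) mod n \<noteq> (j + r) mod n"
      using * mod_eq_dvd_iff_nat[of "i + r" "j + r" n] by auto
  qed auto
  have "(\<lambda>i. (i + r) mod n) ` {..<n} = {..<n}"
    using inj by (intro card_subset_eq) (auto simp: card_image)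
  then have "(\<lambda>i. (i + r) mod n) ` {i\<in>{..<n}. (i + r) mod n < k} = {..<k}"
    using assms by (auto simp: image_iff)
  moreover have "inj_on (\<lambda>i. (i + r) mod n) {i\<in>{..<n}. (i + r) mod n < k}"
    by (rule inj_on_subset[OF inj]) auto
  ultimately show ?thesis
    using card_image by fastforce
qed

text \<open>
  A uniformly random offset \<open>r\<close> gives each agent the signal \<open>Hi\<close> with probability \<open>k / n\<close>, while the
  number of \<open>Hi\<close> signals is always \<open>k\<close>.
\<close>

definition cyclic_profile :: "nat \<Rightarrow> nat \<Rightarrow> nat \<Rightarrow> signal list" where
  "cyclic_profile n k r = map (\<lambda>i. if (i + r) mod n < k then Hi else Lo) [0..<n]"

lemma hi_fraction_cyclic_profile:
  assumes "k \<le> n"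
  shows "hi_fraction (cyclic_profile n k r) = real k / real n"
proof -
  have "{i. i < n \<and> cyclic_profile n k r ! i = Hi} = {i\<in>{..<n}. (i + r) mod n < k}"
    by (auto simp: cyclic_profile_def split: if_splits)
  then show ?thesis
    using card_cyclic_less[OF assms, of r] by (simp add: hi_fraction_def) (simp add: cyclic_profile_def)
qed

text \<open>State and count are drawn from the joint law \<open>p\<close>; an independent uniform
  offset then rotates the block of agents who receive \<open>Hi\<close>.\<close>

lemma info_structure_from_laws:
  assumes "0 < mu" "mu < 1" "p1 < mu" "mu < p2" "0 < n"
    and x: "x \<in> count_laws n (real n * prob_Hi_given_0 mu p1 p2)"
    and y: "y \<in> count_laws n (real n * prob_Hi_given_1 mu p1 p2)"
  shows "\<exists>\<pi>\<in>info_structures n mu p1 p2. state_law n \<pi> False = x \<and> state_law n \<pi> True = y"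
proof -
  define p where "p = (\<lambda>(w, k). if w then mu * y k else (1 - mu) * x k)"
  have p_nonneg: "0 \<le> p z" for z
    using assms by (auto simp: p_def count_laws_def split: prod.splits)
  have p_0: "p z = 0" if "z \<notin> UNIV \<times> {..n}" for z
    using that x y by (cases z) (auto simp: p_def count_laws_def not_le)
  have sum_UNIV: "(\<Sum>z\<in>UNIV \<times> {..n}. g z) = (\<Sum>k\<le>n. g (False, k)) + (\<Sum>k\<le>n. g (True, k))"
    for g :: "bool \<times> nat \<Rightarrow> real"
    using sum.cartesian_product[of "\<lambda>w k. g (w, k)" "{..n}" UNIV] by (simp add: UNIV_bool)
  have "(\<integral>\<^sup>+ z. ennreal (p z) \<partial>count_space UNIV) = (\<Sum>z\<in>UNIV \<times> {..n}. ennreal (p z))"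
    by (rule nn_integral_count_space') (auto simp: p_0)
  also have "\<dots> = ennreal (\<Sum>z\<in>UNIV \<times> {..n}. p z)"
    by (simp add: p_nonneg)
  also have "(\<Sum>z\<in>UNIV \<times> {..n}. p z) = 1"
    unfolding sum_UNIV using x y by (simp add: p_def count_laws_def flip: sum_distrib_left)
  finally have total: "(\<integral>\<^sup>+ z. ennreal (p z) \<partial>count_space UNIV) = 1" by simp
  define J where "J = embed_pmf p"
  have pmf_J: "pmf J z = p z" for z
    unfolding J_def by (rule pmf_embed_pmf[OF p_nonneg total])
  have set_J: "set_pmf J \<subseteq> UNIV \<times> {..n}"
    using p_0 by (fastforce simp: set_pmf_iff pmf_J)
  have E_J: "measure_pmf.expectation J g = (\<Sum>k\<le>n. g (False, k) * ((1 - mu) * x k)) + (\<Sum>k\<le>n. g (True, k) * (mu * y k))"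
    for g :: "bool \<times> nat \<Rightarrow> real"
  proof -
    have "measure_pmf.expectation J g = (\<Sum>z\<in>UNIV \<times> {..n}. g z * pmf J z)"
      using set_J by (intro integral_measure_pmf_real) auto
    then show ?thesis
      by (simp only: sum_UNIV pmf_J) (simp add: p_def)
  qed
  define \<pi> where "\<pi> = bind_pmf (pmf_of_set {..<n})
    (\<lambda>r. map_pmf (\<lambda>(w, k). (w, cyclic_profile n k r)) J)"
  have len: "\<forall>z\<in>set_pmf \<pi>. length (snd z) = n"
    by (auto simp: \<pi>_def cyclic_profile_def)
  \<comment> \<open>The fraction of \<open>Hi\<close> signals is the same for every offset, so the
    offset disappears from \<open>hat\<close>.\<close>
  have "hat \<pi> = bind_pmf (pmf_of_set {..<n}) (\<lambda>r. map_pmf (\<lambda>(w, k). (w, real k / real n)) J)"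
    unfolding hat_def \<pi>_def map_bind_pmf
    by (intro bind_pmf_cong refl, simp add: pmf.map_comp, intro map_pmf_cong refl)
      (use set_J in \<open>auto simp: hi_fraction_cyclic_profile\<close>)
  then have hat: "hat \<pi> = map_pmf (\<lambda>(w, k). (w, real k / real n)) J" by simp
  have pmf_hat: "pmf (hat \<pi>) (w, real k / real n) = p (w, k)" if "k \<le> n" for w k
  proof -
    have "inj (\<lambda>(w :: bool, k). (w, real k / real n))"
      using assms by (auto simp: inj_def)
    then show ?thesis
      using pmf_map_inj'[of "\<lambda>(w :: bool, k). (w, real k / real n)" J "(w, k)"] by (simp add: hat pmf_J)
  qed
  have prob_state: "measure_pmf.prob \<pi> {z. fst z = w} = (if w then mu else 1 - mu)" for w
  proof -
    have "measure_pmf.prob \<pi> {z. fst z = w} = measure_pmf.prob (hat \<pi>) {z. fst z = w}"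
      by (simp add: hat_def vimage_def case_prod_beta)
    also have "\<dots> = measure_pmf.prob J {z. fst z = w}"
      by (simp add: hat vimage_def case_prod_beta)
    also have "\<dots> = measure_pmf.expectation J (indicator {z. fst z = w})"
      by simp
    also have "\<dots> = (if w then mu else 1 - mu)"
      unfolding E_J using x y by (cases w) (simp_all add: count_laws_def flip: sum_distrib_left)
    finally show ?thesis .
  qed
  have prob_Hi: "measure_pmf.prob \<pi> {z. fst z = w \<and> snd z ! i = Hi}
      = (if w then mu * prob_Hi_given_1 mu p1 p2 else (1 - mu) * prob_Hi_given_0 mu p1 p2)"
    if i: "i < n" for w i
  proof -
    let ?h = "indicator {z. fst z = w \<and> snd z ! i = Hi} :: outcome \<Rightarrow> real"
    have ind: "?h (w', cyclic_profile n k r) = of_bool (w' = w) * of_bool ((r + i) mod n < k)" for w' k r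
      using i by (simp add: indicator_def cyclic_profile_def add.commute)
    \<comment> \<open>The roles of agent and offset are exchanged: for a fixed agent,
      \<open>k\<close> of the \<open>n\<close> offsets give \<open>Hi\<close>.\<close>
    have cnt: "(\<Sum>r<n. of_bool ((r + i) mod n < k)) = real k" if "k \<le> n" for k
      using card_cyclic_less[OF that, of i] by (simp add: sum_of_bool_eq Int_def)
    have E_shift: "measure_pmf.expectation (map_pmf (\<lambda>(w, k). (w, cyclic_profile n k r)) J) ?h =
        (\<Sum>k\<le>n. of_bool ((r + i) mod n < k) * (if w then mu * y k else (1 - mu) * x k))" for r
      by (simp only: integral_map_pmf case_prod_beta E_J fst_conv snd_conv ind) (cases w; simp)
    have "measure_pmf.prob \<pi> {z. fst z = w \<and> snd z ! i = Hi} = measure_pmf.expectation \<pi> ?h"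
      by simp
    also have "\<dots> = (\<Sum>r<n. measure_pmf.expectation (map_pmf (\<lambda>(w, k). (w, cyclic_profile n k r)) J) ?h /\<^sub>R real (card {..<n}))"
      unfolding \<pi>_def
      by (rule pmf_expectation_bind_pmf_of_set)
        (use assms in \<open>auto intro!: finite_subset[OF set_J] simp: lessThan_empty_iff\<close>)
    also have "\<dots> = (\<Sum>r<n. \<Sum>k\<le>n. of_bool ((r + i) mod n < k) *
        ((if w then mu * y k else (1 - mu) * x k) / real n))"
      unfolding E_shift
      by (simp add: sum_distrib_left divide_inverse mult_ac del: sum_of_bool_mult_eq sum_mult_of_bool_eq)
    also have "\<dots> = (\<Sum>k\<le>n. (\<Sum>r<n. of_bool ((r + i) mod n < k)) *
        ((if w then mu * y k else (1 - mu) * x k) / real n))"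
      by (subst sum.swap) (simp only: sum_distrib_right)
    also have "\<dots> = (\<Sum>k\<le>n. real k * (if w then y k else x k)) * ((if w then mu else 1 - mu) / real n)"
      unfolding sum_distrib_right[of _ "{..n}"]
      by (intro sum.cong refl) (simp only: atMost_iff cnt, cases w, simp_all)
    finally show ?thesis
      using x y assms by (simp add: count_laws_def)
  qed
  have "\<pi> \<in> info_structures n mu p1 p2"
    using len prob_state[of True] prob_Hi[where w = True] prob_Hi[where w = False] assms
    by (simp add: info_structures_iff)
  moreover have "pmf (hat_cond w \<pi>) (real k / real n) = (if w then y k else x k)" if "k \<le> n" for w k
    using pmf_hat_cond[of \<pi> w "real k / real n"] prob_state[of w] pmf_hat[OF that, of w] assms
    by (cases w) (auto simp: p_def)
  then have "state_law n \<pi> False = x" "state_law n \<pi> True = y"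
    using x y by (auto simp: state_law_def count_laws_def fun_eq_iff)
  ultimately show ?thesis by blast
qed

text \<open>Both translations together replace information structures by a product of two compact
  sets: the two conditional laws can be chosen independently.\<close>

lemma appr_ratio_image:
  assumes "0 < mu" "mu < 1" "p1 < mu" "mu < p2" "0 < n"
  shows "appr_ratio mu f ` info_structures n mu p1 p2 =
    (\<lambda>(x, y). correct_of_laws n mu (\<lambda>k. f (real k / real n)) x y / bayes_of_laws n mu x y) `
      (count_laws n (real n * prob_Hi_given_0 mu p1 p2) \<times> count_laws n (real n * prob_Hi_given_1 mu p1 p2))"
    (is "_ = ?R ` ?S")
proof -
  have ratio: "appr_ratio mu f \<pi> = ?R (state_law n \<pi> False, state_law n \<pi> True)"
    if "\<pi> \<in> info_structures n mu p1 p2" for \<pi>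
    using that assms by (simp add: appr_ratio_def prob_correct_eq_laws bayes_prob_correct_eq_laws)
  show ?thesis
  proof (intro equalityI image_subsetI)
    show "appr_ratio mu f \<pi> \<in> ?R ` ?S" if "\<pi> \<in> info_structures n mu p1 p2" for \<pi>
      using that state_law_in_count_laws[OF that] assms by (auto simp: ratio intro!: image_eqI)
    show "?R z \<in> appr_ratio mu f ` info_structures n mu p1 p2" if "z \<in> ?S" for z
      using that info_structure_from_laws[of mu p1 p2 n "fst z" "snd z"] assms ratio
      by (cases z) (force simp del: split_conv)
  qed
qed

text \<open>\<open>LEAST\<close> on the reals can be evaluated once a minimum is known to exist,
  which compactness provides.\<close>

lemma rule_appr_least:
  assumes "0 < mu" "mu < 1" "p1 < mu" "mu < p2" "0 < n"
    and "count_laws n (real n * prob_Hi_given_0 mu p1 p2) \<noteq> {}"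
    and "count_laws n (real n * prob_Hi_given_1 mu p1 p2) \<noteq> {}"
  shows "rule_appr n mu p1 p2 f \<in> appr_ratio mu f ` info_structures n mu p1 p2"
    and "\<And>r. r \<in> appr_ratio mu f ` info_structures n mu p1 p2 \<Longrightarrow> rule_appr n mu p1 p2 f \<le> r"
proof -
  let ?I = "appr_ratio mu f ` info_structures n mu p1 p2"
  let ?F = "\<lambda>k. f (real k / real n)"
  let ?ratio = "\<lambda>x y. correct_of_laws n mu ?F x y / bayes_of_laws n mu x y"
  let ?X = "count_laws n (real n * prob_Hi_given_0 mu p1 p2)"
  let ?Y = "count_laws n (real n * prob_Hi_given_1 mu p1 p2)"
  obtain x y where xy: "x \<in> ?X" "y \<in> ?Y" "\<forall>x'\<in>?X. \<forall>y'\<in>?Y. ?ratio x y \<le> ?ratio x' y'"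
    using ratio_of_laws_attains_min[OF assms(6,7,1,2), of ?F] by blast
  obtain r where r: "r \<in> ?I" "\<And>r'. r' \<in> ?I \<Longrightarrow> r \<le> r'"
  proof
    show "?ratio x y \<in> ?I"
      unfolding appr_ratio_image[OF assms(1-5)] by (rule image_eqI[where x = "(x, y)"]) (use xy in simp_all)
    show "?ratio x y \<le> r'" if "r' \<in> ?I" for r'
      using that xy(3) unfolding appr_ratio_image[OF assms(1-5)] by (elim imageE SigmaE) simp
  qed
  then have "rule_appr n mu p1 p2 f = r"
    unfolding rule_appr_def by (intro Least_equality)
  then show "rule_appr n mu p1 p2 f \<in> ?I" "\<And>r'. r' \<in> ?I \<Longrightarrow> rule_appr n mu p1 p2 f \<le> r'"
    using r by auto
qed

section \<open>Optimality of the random dictator\<close>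

theorem proposition6p6:
  fixes n :: nat and mu p1 p2 a b :: real
  assumes "n \<ge> 1"
    and "0 < mu" and "mu < 1"
    and "0 \<le> p1" and "p1 < 1/2" and "1/2 < p2" and "p2 \<le> 1"
    and "p1 < mu" and "mu < p2"
    and a_def: "a = prob_Hi_given_0 mu p1 p2"
    and b_def: "b = prob_Hi_given_1 mu p1 p2"
    and "1 / real n \<le> a" and "a < b" and "b \<le> (real n - 1) / real n"
  shows "(\<forall>f. is_arg_max (rule_appr n mu p1 p2) (\<lambda>f. f \<in> aggregation_rules n) f
              \<longleftrightarrow> f = random_dictator n) \<and>
         best_appr n mu p1 p2 = (1 - mu) * (1 - a) + mu * b"
proof -
  let ?X = "count_laws n (real n * a)" and ?Y = "count_laws n (real n * b)"
  let ?rd = "random_dictator n" and ?appr = "rule_appr n mu p1 p2"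
  define R where "R = (1 - mu) * (1 - a) + mu * b"
  have n: "0 < n" using assms by simp
  have A: "1 \<le> real n * a" "real n * a < real n * b" "real n * b \<le> real n - 1"
    using assms n by (simp_all add: field_simps)
  then have n3: "3 \<le> n" by linarith
  \<comment> \<open>Given \<open>Hi\<close>, state 1 is the likelier one, as \<open>p2\<close>
    exceeds 1/2.\<close>
  have above: "(1 - mu) * a < mu * b"
  proof -
    have "(1 - mu) * a = (1 - p2) * ((mu - p1) / (p2 - p1))" "mu * b = p2 * ((mu - p1) / (p2 - p1))"
      using assms by (simp_all add: a_def b_def prob_Hi_given_0_def prob_Hi_given_1_def)
    moreover have "0 < (mu - p1) / (p2 - p1)" using assms by simp
    ultimately show ?thesis using assms by (simp del: times_divide_eq_right)
  qed
  \<comment> \<open>Given \<open>Lo\<close>, state 0 is the likelier one, as \<open>p1\<close> is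
    below 1/2.\<close>
  have below: "mu * (1 - b) < (1 - mu) * (1 - a)"
  proof -
    have pos: "0 < p2 - p1" using assms by simp
    have "mu * b = p2 * (mu - p1) / (p2 - p1)" "(1 - mu) * a = (1 - p2) * (mu - p1) / (p2 - p1)"
      using assms by (simp_all add: a_def b_def prob_Hi_given_0_def prob_Hi_given_1_def)
    then have "(p2 - p1) * (mu * b) = p2 * (mu - p1)" "(p2 - p1) * ((1 - mu) * a) = (1 - p2) * (mu - p1)"
      using pos by simp_all
    then have "(p2 - p1) * ((1 - mu) * (1 - a) - mu * (1 - b)) = (1 - 2 * p1) * (p2 - mu)"
      by (simp add: algebra_simps)
    moreover have "0 < (1 - 2 * p1) * (p2 - mu)" using assms by simp
    ultimately show ?thesis
      using zero_less_mult_pos[OF _ pos, of "(1 - mu) * (1 - a) - mu * (1 - b)"] by simp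
  qed
  have img: "appr_ratio mu f ` info_structures n mu p1 p2 =
    (\<lambda>(x, y). correct_of_laws n mu (\<lambda>k. f (real k / real n)) x y / bayes_of_laws n mu x y) ` (?X \<times> ?Y)" for f
    unfolding a_def b_def by (rule appr_ratio_image) (use assms n in auto)
  have x0: "two_point_law 0 n (real n * a) \<in> ?X" and y0: "two_point_law 1 (n - 1) (real n * b) \<in> ?Y"
  proof -
    have "real (n - 1) = real n - 1" "0 \<le> real n * a" "real n * a \<le> real n" "1 \<le> real n * b"
      using A n3 by linarith+
    then show "two_point_law 0 n (real n * a) \<in> ?X" "two_point_law 1 (n - 1) (real n * b) \<in> ?Y"
      using A(3) n3 by (auto intro!: two_point_law_in_count_laws)
  qed
  then have ne: "?X \<noteq> {}" "?Y \<noteq> {}" by blast+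
  have least: "?appr f \<in> appr_ratio mu f ` info_structures n mu p1 p2"
      "\<And>r. r \<in> appr_ratio mu f ` info_structures n mu p1 p2 \<Longrightarrow> ?appr f \<le> r" for f
    using rule_appr_least[OF assms(2,3,8,9) n, folded a_def b_def, OF ne] by blast+
  \<comment> \<open>For disjoint supports the Bayesian benchmark is 1, so the ratio is the success
    probability itself.\<close>
  have upper: "?appr f \<le> correct_of_laws n mu (\<lambda>k. f (real k / real n)) x y"
    if "x \<in> ?X" "y \<in> ?Y" "\<And>k. x k = 0 \<or> y k = 0" for f x y
  proof -
    have "correct_of_laws n mu (\<lambda>k. f (real k / real n)) x y / bayes_of_laws n mu x y
        \<in> appr_ratio mu f ` info_structures n mu p1 p2"
      unfolding img using that by force
    from least(2)[OF this] show ?thesis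
      using bayes_of_laws_disjoint[of x n _ y _ mu] that assms by simp
  qed
  have frac: "real k / real n \<in> fractions n" if "k \<le> n" for k
    using that by (auto simp: fractions_def)
  have rd: "?rd \<in> aggregation_rules n"
    using n by (auto simp: random_dictator_def aggregation_rules_def fractions_def divide_le_eq)
  have rd_correct: "correct_of_laws n mu (\<lambda>k. ?rd (real k / real n)) x y = R"
    if "x \<in> ?X" "y \<in> ?Y" for x y
    using frac by (simp add: correct_of_laws_eq[OF that n] R_def random_dictator_def)
  have "0 \<le> 1 / real n" "(real n - 1) / real n \<le> 1"
    using n by simp_all
  then have "0 \<le> a" "a \<le> 1" "0 \<le> b" "b \<le> 1"
    using assms(12-14) by linarith+
  then have "0 \<le> R" using assms(2,3) by (simp add: R_def)
  \<comment> \<open>The disjoint pair attains \<open>R\<close>; elsewhere the numerator is still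
    \<open>R\<close> and the denominator at most 1.\<close>
  have appr_rd: "?appr ?rd = R"
  proof (rule antisym)
    show "?appr ?rd \<le> R"
      using upper[OF x0 y0 two_point_law_disjoint, of ?rd] rd_correct[OF x0 y0] n3 by simp
    obtain x y where xy: "x \<in> ?X" "y \<in> ?Y" "?appr ?rd = R / bayes_of_laws n mu x y"
      using least(1)[of ?rd] unfolding img by (auto simp: rd_correct)
    then show "R \<le> ?appr ?rd"
      using bayes_of_laws_bounds[OF xy(1,2)] assms \<open>0 \<le> R\<close> by (simp add: le_divide_eq mult_left_le)
  qed
  have worse: "?appr f < R" if f: "f \<in> aggregation_rules n" "f \<noteq> ?rd" for f
  proof (rule ccontr)
    assume *: "\<not> ?appr f < R"
    define g where "g = (\<lambda>k. f (real k / real n) - real k / real n)"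
    have range: "f (real k / real n) \<in> {0..1}" if "k \<le> n" for k
      using f(1) frac[OF that] by (auto simp: aggregation_rules_def)
    have test: "(1 - mu) * two_point_mean i j (real n * a) g \<le> mu * two_point_mean k l (real n * b) g"
      if "i < j" "j \<le> n" "k < l" "l \<le> n" "{i, j} \<inter> {k, l} = {}"
        "real i \<le> real n * a" "real n * a \<le> real j" "real k \<le> real n * b" "real n * b \<le> real l" for i j k l
    proof -
      let ?x = "two_point_law i j (real n * a)" and ?y = "two_point_law k l (real n * b)"
      have xy: "?x \<in> ?X" "?y \<in> ?Y"
        using that by (simp_all add: two_point_law_in_count_laws)
      have "R \<le> correct_of_laws n mu (\<lambda>k. f (real k / real n)) ?x ?y"
        using * upper[OF xy two_point_law_disjoint[OF that(5)], of f] by linarith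
      then show ?thesis
        using that
        by (simp add: correct_of_laws_eq[OF xy n] R_def sum_two_point_law flip: g_def)
    qed
    have "g k = 0" if "k \<le> n" for k
    proof (rule two_point_tests_imp_zero[where A = "real n * a" and B = "real n * b" and mu = mu and n = n])
      show "mu * (real n - real n * b) < (1 - mu) * (real n - real n * a)"
        using mult_strict_left_mono[OF below, of "real n"] n by (simp add: algebra_simps)
      show "(1 - mu) * (real n * a) < mu * (real n * b)"
        using mult_strict_left_mono[OF above, of "real n"] n by (simp add: algebra_simps)
      \<comment> \<open>A rule takes values in [0,1], so it can only deviate upwards at 0 and
        downwards at 1.\<close>
      show "0 \<le> g 0" "g n \<le> 0"
        using range[of 0] range[of n] n by (auto simp: g_def)
    qed (fact A assms(2,3) that | rule test; assumption)+
    then have "f \<nu> = \<nu>" if "\<nu> \<in> fractions n" for \<nu>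
      using that by (auto simp: fractions_def g_def)
    \<comment> \<open>Both rules are extensional, so agreement on \<open>fractions n\<close> is
      equality.\<close>
    then have "f = ?rd"
      using f(1) unfolding aggregation_rules_def random_dictator_def
      by (intro extensionalityI[of _ "fractions n"]) (auto simp: PiE_def)
    then show False using f(2) by contradiction
  qed
  have "is_arg_max ?appr (\<lambda>f. f \<in> aggregation_rules n) f \<longleftrightarrow> f = ?rd" for f
    using rd appr_rd worse unfolding is_arg_max_def by (metis less_irrefl less_asym)
  moreover have "best_appr n mu p1 p2 = R"
    unfolding best_appr_def
  proof (rule Greatest_equality)
    show "R \<in> ?appr ` aggregation_rules n" using rd appr_rd by blast
    show "r \<le> R" if "r \<in> ?appr ` aggregation_rules n" for r
      using that worse appr_rd by (metis imageE less_eq_real_def)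
  qed
  ultimately show ?thesis by (simp add: R_def)
qed

end
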